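(* Let $\mathbb{F}_q$ be the finite field with $q$ elements. Each SQR class in $M_2(\mathbb{F}_q)$ (i.e. each set $\mathcal{C}((x-a)^2)$ of all matrices in $M_2(\mathbb{F}_q)$ with minimal polynomial $(x-a)^2$, where $a\in\mathbb{F}_q$) contains exactly $(q+1)(2^{q-1}-1)$ noncore subsets.
   Context: $M_2(\mathbb{F}_q)$ is the ring of $2\times 2$ matrices over $\mathbb{F}_q$. In the polynomial ring $M_2(\mathbb{F}_q)[x]$ the variable $x$ commutes with all coefficients, and polynomials are evaluated from the right: for $f=\sum_i \alpha_i x^i$ with $\alpha_i\in M_2(\mathbb{F}_q)$ and $A\in M_2(\mathbb{F}_q)$, $f(A)=\sum_i \alpha_i A^i$. For $S\subseteq M_2(\mathbb{F}_q)$, the null ideal of $S$ is $N(S)=\{f\in M_2(\mathbb{F}_q)[x] \mid f(A)=0 \text{ for all } A\in S\}$. The set $S$ is called core if $N(S)$ is a two-sided ideal of $M_2(\mathbb{F}_q)[x]$, and noncore otherwise. The empty set is core. *)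

theory Defs
  imports "Jordan_Normal_Form.Matrix" "HOL-Algebra.UnivPoly" "HOL-Algebra.Ideal"
    "HOL-Computational_Algebra.Polynomial"
begin

abbreviation M2 :: "'a::field mat ring" where
  "M2 \<equiv> ring_mat TYPE('a) 2 ()"

text \<open>
  Polynomials with matrix coefficients are elements of \<^term>\<open>UP M2\<close>; the type \<^typ>\<open>'a poly\<close> is
  not available for them, since its multiplication requires commuting coefficients.
  The library evaluation \<^const>\<open>eval\<close> puts the coefficients on the left of the powers of \<open>A\<close>, that is,
  \<open>f(A) = \<Sum>i. \<alpha>\<^sub>i A\<^sup>i\<close>. It is not multiplicative in \<open>f\<close>.
\<close>

definition eval_M2 :: "(nat \<Rightarrow> 'a::field mat) \<Rightarrow> 'a mat \<Rightarrow> 'a mat" where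
  "eval_M2 f A = eval M2 M2 (\<lambda>\<alpha>. \<alpha>) A f"

definition null_ideal :: "'a::field mat set \<Rightarrow> (nat \<Rightarrow> 'a mat) set" where
  "null_ideal S = {f \<in> carrier (UP M2). \<forall>A\<in>S. eval_M2 f A = \<zero>\<^bsub>M2\<^esub>}"

text \<open>The locale \<^locale>\<open>ideal\<close> describes two-sided ideals.\<close>

definition core :: "'a::field mat set \<Rightarrow> bool" where
  "core S \<longleftrightarrow> ideal (null_ideal S) (UP M2)"

abbreviation noncore :: "'a::field mat set \<Rightarrow> bool" where
  "noncore S \<equiv> \<not> core S"

definition scalar_poly_eval :: "'a::field poly \<Rightarrow> 'a mat \<Rightarrow> 'a mat" where
  "scalar_poly_eval p A = (\<Oplus>\<^bsub>M2\<^esub>i\<in>{..degree p}. poly.coeff p i \<cdot>\<^sub>m (A ^\<^sub>m i))"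

definition is_min_poly :: "'a::field mat \<Rightarrow> 'a poly \<Rightarrow> bool" where
  "is_min_poly A p \<longleftrightarrow>
     lead_coeff p = 1 \<and> scalar_poly_eval p A = \<zero>\<^bsub>M2\<^esub> \<and>
     (\<forall>r. r \<noteq> 0 \<and> scalar_poly_eval r A = \<zero>\<^bsub>M2\<^esub> \<longrightarrow> degree p \<le> degree r)"

definition min_poly_class :: "'a::field poly \<Rightarrow> 'a mat set" where
  "min_poly_class m = {A \<in> carrier M2. is_min_poly A m}"

definition SQR_class :: "'a::field \<Rightarrow> 'a mat set" where
  "SQR_class a = min_poly_class ([:- a, 1:] ^ 2)"

end

theory Submission
  imports Defs "HOL-Library.Cardinality"
begin

text \<open>
  For \<open>N\<^sup>2 = 0\<close> the evaluation is \<open>f(a + N) = f(a) + f'(a) N\<close>. The SQR class of \<open>a\<close> consists of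
  the matrices \<open>a + N\<close> with \<open>N \<noteq> 0\<close> nilpotent, so it is the disjoint union of \<open>q + 1\<close> punctured
  lines \<open>{a + c M | c \<noteq> 0}\<close>, one for each kernel. If \<open>S\<close> contains \<open>a + N\<close> and \<open>a + N'\<close> from two
  different lines, then \<open>N - N'\<close> is invertible, hence \<open>f(a) = f'(a) = 0\<close> for all \<open>f\<close> in the null
  ideal, which is therefore generated by the central polynomial \<open>(x - a)\<^sup>2\<close>, and \<open>S\<close> is core. If \<open>S\<close>
  is a nonempty subset of the line of \<open>M\<close>, then \<open>M(x - a)\<close> lies in the null ideal, but
  \<open>M(x - a)E\<close> does not once \<open>M E M \<noteq> 0\<close>, and \<open>S\<close> is noncore.
\<close>

section \<open>Entrywise computation with two-by-two matrices\<close>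

lemma mat2_mult_index:
  assumes "A \<in> carrier_mat 2 2" "B \<in> carrier_mat 2 2" "r < 2" "c < 2"
  shows "(A * B) $$ (r, c) = A $$ (r, 0) * B $$ (0, c) + A $$ (r, 1) * B $$ (1, c)"
  using assms by (auto simp: scalar_prod_def numeral_2_eq_2)

lemma mat2_eqI:
  assumes "A \<in> carrier_mat 2 2" "B \<in> carrier_mat 2 2"
    and "\<And>r c. r < 2 \<Longrightarrow> c < 2 \<Longrightarrow> A $$ (r, c) = B $$ (r, c)"
  shows "A = B"
  using assms by (intro eq_matI) auto

lemma M2_pow:
  assumes "A \<in> carrier_mat 2 2"
  shows "A [^]\<^bsub>M2\<^esub> (n::nat) = A ^\<^sub>m n"
  using pow_mat_ring_pow[OF assms] by metis

lemma M2_finsum_index: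
  fixes F :: "'b \<Rightarrow> 'a::field mat"
  assumes "finite I" "\<And>i. i \<in> I \<Longrightarrow> F i \<in> carrier_mat 2 2" "r < 2" "c < 2"
  shows "(\<Oplus>\<^bsub>M2\<^esub>i\<in>I. F i) $$ (r, c) = (\<Sum>i\<in>I. F i $$ (r, c))"
  using assms(1,2)
proof (induction rule: finite_induct)
  case empty
  interpret ring "M2 :: 'a mat ring" by (rule ring_mat)
  show ?case using assms by (simp add: ring_mat_simps)
next
  case (insert x I)
  interpret ring "M2 :: 'a mat ring" by (rule ring_mat)
  have "(\<Oplus>\<^bsub>M2\<^esub>i\<in>I. F i) \<in> carrier_mat 2 2"
    using insert finsum_closed[of F I] by (auto simp: ring_mat_simps)
  moreover have "(\<Oplus>\<^bsub>M2\<^esub>i\<in>insert x I. F i) = F x + (\<Oplus>\<^bsub>M2\<^esub>i\<in>I. F i)"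
    using insert finsum_insert[of I x F] by (auto simp: ring_mat_simps)
  ultimately show ?case using insert assms by simp
qed

lemma M2_finsum_carrier:
  fixes F :: "'b \<Rightarrow> 'a::field mat"
  assumes "\<And>i. i \<in> I \<Longrightarrow> F i \<in> carrier_mat 2 2"
  shows "(\<Oplus>\<^bsub>M2\<^esub>i\<in>I. F i) \<in> carrier_mat 2 2"
proof -
  interpret ring "M2 :: 'a mat ring" by (rule ring_mat)
  show ?thesis using assms finsum_closed[of F I] by (auto simp: ring_mat_simps)
qed

section \<open>Scalar polynomials at a scalar plus a square-zero matrix\<close>

lemma pderiv_sum: "pderiv (sum p I) = (\<Sum>i\<in>I. pderiv (p i))"
  by (induction I rule: infinite_finite_induct) (auto simp: pderiv_add)

lemma poly_pderiv_sum:
  fixes p :: "'a::field poly"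
  assumes "degree p \<le> n"
  shows "poly p a = (\<Sum>i\<le>n. coeff p i * a ^ i)"
    and "poly (pderiv p) a = (\<Sum>i\<le>n. coeff p i * (of_nat i * a ^ (i - 1)))"
proof -
  have p: "p = (\<Sum>i\<le>n. monom (coeff p i) i)"
    using poly_as_sum_of_monoms'[OF assms] by simp
  show "poly p a = (\<Sum>i\<le>n. coeff p i * a ^ i)"
    by (subst p) (simp add: poly_sum poly_monom)
  show "poly (pderiv p) a = (\<Sum>i\<le>n. coeff p i * (of_nat i * a ^ (i - 1)))"
  proof -
    have "pderiv p = (\<Sum>i\<le>n. pderiv (monom (coeff p i) i))"
      using arg_cong[OF p, of pderiv] by (simp add: pderiv_sum)
    then show ?thesis by (simp add: poly_sum poly_monom pderiv_monom mult_ac)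
  qed
qed

locale square_zero =
  fixes N :: "'a::field mat"
  assumes carrier_N [simp]: "N \<in> carrier_mat 2 2"
    and square_N: "N * N = 0\<^sub>m 2 2"
begin

lemma dim_N [simp]: "dim_row N = 2" "dim_col N = 2"
  using carrier_matD[OF carrier_N] by auto

text \<open>The scalar part commutes with \<open>N\<close>, so the binomial expansion applies, and
  \<open>N * N = 0\<close> leaves its first two terms. At \<open>n = 0\<close> the factor
  \<open>of_nat n\<close> makes the truncated exponent \<open>n - 1\<close> harmless.\<close>

lemma pow_scalar_plus:
  "(a \<cdot>\<^sub>m 1\<^sub>m 2 + N) ^\<^sub>m n = a ^ n \<cdot>\<^sub>m 1\<^sub>m 2 + (of_nat n * a ^ (n - 1)) \<cdot>\<^sub>m N"
proof (induction n)
  case 0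
  show ?case using carrier_N by (intro mat2_eqI) auto
next
  case (Suc n)
  have sq: "N $$ (r, 0) * N $$ (0, c) + N $$ (r, 1) * N $$ (1, c) = 0"
    if "r < 2" "c < 2" for r c
    using mat2_mult_index[OF carrier_N carrier_N that] that by (simp add: square_N)
  let ?B = "a ^ n \<cdot>\<^sub>m 1\<^sub>m 2 + (of_nat n * a ^ (n - 1)) \<cdot>\<^sub>m N"
  show ?case
  proof (rule mat2_eqI)
    fix r c :: nat assume rc: "r < 2" "c < 2"
    have n: "of_nat n * a ^ (n - 1) * a = of_nat n * a ^ n"
      by (cases n) auto
    have "(?B * (a \<cdot>\<^sub>m 1\<^sub>m 2 + N)) $$ (r, c) =
      ?B $$ (r, 0) * (a \<cdot>\<^sub>m 1\<^sub>m 2 + N) $$ (0, c) + ?B $$ (r, 1) * (a \<cdot>\<^sub>m 1\<^sub>m 2 + N) $$ (1, c)"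
      using rc carrier_N by (intro mat2_mult_index) auto
    \<comment> \<open>The terms are sorted so that the last bracket is an entry of
      \<open>N * N\<close>, which \<open>sq\<close> removes.\<close>
    also have "\<dots> = (if r = c then a ^ n * a else 0) + a ^ n * N $$ (r, c)
        + of_nat n * a ^ (n - 1) * a * N $$ (r, c)
        + of_nat n * a ^ (n - 1) *
          (N $$ (r, 0) * N $$ (0, c) + N $$ (r, 1) * N $$ (1, c))"
      using rc carrier_N by (auto simp: less_2_cases_iff algebra_simps)
    also have "\<dots> = (a ^ Suc n \<cdot>\<^sub>m 1\<^sub>m 2 + (of_nat (Suc n) * a ^ (Suc n - 1)) \<cdot>\<^sub>m N) $$ (r, c)"
      unfolding sq[OF rc] n using rc by (simp add: algebra_simps)
    finally show "((a \<cdot>\<^sub>m 1\<^sub>m 2 + N) ^\<^sub>m Suc n) $$ (r, c) = \<dots>"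
      by (simp add: Suc)
  qed (use carrier_N in auto)
qed

text \<open>First-order Taylor formula; with the formal derivative it holds in every
  characteristic.\<close>

lemma scalar_poly_eval_scalar_plus:
  assumes "r < 2" "c < 2"
  shows "scalar_poly_eval p (a \<cdot>\<^sub>m 1\<^sub>m 2 + N) $$ (r, c) =
    (if r = c then poly p a else 0) + poly (pderiv p) a * N $$ (r, c)"
proof -
  have "scalar_poly_eval p (a \<cdot>\<^sub>m 1\<^sub>m 2 + N) $$ (r, c) =
    (\<Sum>i\<le>degree p. coeff p i * (if r = c then a ^ i else 0)
      + coeff p i * (of_nat i * a ^ (i - 1)) * N $$ (r, c))"
    unfolding scalar_poly_eval_def pow_scalar_plus using assms carrier_N
    by (subst M2_finsum_index) (auto intro!: sum.cong simp: algebra_simps)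
  also have "\<dots> = (if r = c then poly p a else 0) + poly (pderiv p) a * N $$ (r, c)"
    unfolding poly_pderiv_sum[of p, OF order_refl, of a] sum.distrib sum_distrib_right by simp
  finally show ?thesis .
qed

end

section \<open>Matrix polynomials through their entries\<close>

text \<open>
  Under \<open>M\<^sub>2(F)[x] \<cong> M\<^sub>2(F[x])\<close> the entries of \<open>f\<close> become polynomials over the field, for which
  \<^const>\<open>poly\<close> and \<^const>\<open>pderiv\<close> are available.
\<close>
definition entry_poly :: "(nat \<Rightarrow> 'a::field mat) \<Rightarrow> nat \<Rightarrow> nat \<Rightarrow> 'a poly" where
  "entry_poly f r c = Abs_poly (\<lambda>i. f i $$ (r, c))"

context
  fixes f :: "nat \<Rightarrow> 'a::field mat"
  assumes f: "f \<in> carrier (UP M2)"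
begin

lemma UP_M2_coeff_carrier: "f i \<in> carrier_mat 2 2"
  using f by (auto simp: UP_def up_def ring_mat_simps)

lemma UP_M2_deg: "deg M2 f < i \<Longrightarrow> f i = 0\<^sub>m 2 2"
proof -
  assume i: "deg M2 f < i"
  interpret UP_ring "M2 :: 'a mat ring" "UP M2"
    by (simp add: UP_ring_def ring_mat)
  show ?thesis using deg_aboveD[OF i f] f by (simp add: UP_def ring_mat_simps)
qed

lemma coeff_entry_poly:
  assumes "r < 2" "c < 2"
  shows "coeff (entry_poly f r c) i = f i $$ (r, c)"
  unfolding entry_poly_def
  \<comment> \<open>\<open>Abs_poly\<close> is meaningful only for sequences that vanish eventually;
    the degree of \<open>f\<close> supplies the bound.\<close>
  by (subst coeff_Abs_poly[where n = "deg M2 f"]) (use assms in \<open>auto simp: UP_M2_deg\<close>)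

lemma degree_entry_poly:
  assumes "r < 2" "c < 2"
  shows "degree (entry_poly f r c) \<le> deg M2 f"
  by (rule degree_le) (use assms in \<open>auto simp: coeff_entry_poly UP_M2_deg\<close>)

end

text \<open>Taylor formula for matrix coefficients. They stand to the left of \<open>N\<close>, so
  row \<open>r\<close> of the value involves only row \<open>r\<close> of \<open>f\<close>, and null
  conditions can be solved row by row.\<close>

lemma (in square_zero) eval_M2_scalar_plus:
  assumes f: "f \<in> carrier (UP M2)" and rc: "r < 2" "c < 2"
  shows "eval_M2 f (a \<cdot>\<^sub>m 1\<^sub>m 2 + N) $$ (r, c) = poly (entry_poly f r c) a
    + poly (pderiv (entry_poly f r 0)) a * N $$ (0, c)
    + poly (pderiv (entry_poly f r 1)) a * N $$ (1, c)"
proof -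
  note [simp] = UP_M2_coeff_carrier[OF f]
  have A: "a \<cdot>\<^sub>m 1\<^sub>m 2 + N \<in> carrier_mat 2 2" using carrier_N by simp
  have fi: "f i * (x \<cdot>\<^sub>m 1\<^sub>m 2 + y \<cdot>\<^sub>m N) \<in> carrier_mat 2 2" for i x y
    using carrier_N by (intro mult_carrier_mat[where n = 2]) auto
  have "eval_M2 f (a \<cdot>\<^sub>m 1\<^sub>m 2 + N) =
    (\<Oplus>\<^bsub>M2\<^esub>i\<in>{..deg M2 f}. f i * (a ^ i \<cdot>\<^sub>m 1\<^sub>m 2 + (of_nat i * a ^ (i - 1)) \<cdot>\<^sub>m N))"
    using f by (simp add: eval_M2_def eval_def M2_pow[OF A] pow_scalar_plus ring_mat_simps(1))
      (simp add: UP_def)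
  then have "eval_M2 f (a \<cdot>\<^sub>m 1\<^sub>m 2 + N) $$ (r, c) = (\<Sum>i\<le>deg M2 f.
      (f i * (a ^ i \<cdot>\<^sub>m 1\<^sub>m 2 + (of_nat i * a ^ (i - 1)) \<cdot>\<^sub>m N)) $$ (r, c))"
    using rc fi by (simp add: M2_finsum_index)
  also have "\<dots> = (\<Sum>i\<le>deg M2 f. f i $$ (r, c) * a ^ i
      + f i $$ (r, 0) * (of_nat i * a ^ (i - 1)) * N $$ (0, c)
      + f i $$ (r, 1) * (of_nat i * a ^ (i - 1)) * N $$ (1, c))"
  proof (rule sum.cong)
    fix i
    show "(f i * (a ^ i \<cdot>\<^sub>m 1\<^sub>m 2 + (of_nat i * a ^ (i - 1)) \<cdot>\<^sub>m N)) $$ (r, c) =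
      f i $$ (r, c) * a ^ i
      + f i $$ (r, 0) * (of_nat i * a ^ (i - 1)) * N $$ (0, c)
      + f i $$ (r, 1) * (of_nat i * a ^ (i - 1)) * N $$ (1, c)"
      using rc carrier_N by (subst mat2_mult_index) (auto simp: less_2_cases_iff algebra_simps)
  qed simp
  also have "\<dots> = poly (entry_poly f r c) a
    + poly (pderiv (entry_poly f r 0)) a * N $$ (0, c)
    + poly (pderiv (entry_poly f r 1)) a * N $$ (1, c)"
    using rc by (simp add: poly_pderiv_sum[OF degree_entry_poly[OF f]] coeff_entry_poly[OF f]
      sum.distrib sum_distrib_right)
  finally show ?thesis .
qed

lemma eval_M2_carrier:
  assumes "f \<in> carrier (UP M2)" "A \<in> carrier_mat 2 2"
  shows "eval_M2 f A \<in> carrier_mat 2 2"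
proof -
  have "f i * A [^]\<^bsub>M2\<^esub> i \<in> carrier_mat 2 2" for i :: nat
    using assms UP_M2_coeff_carrier[OF assms(1), of i] pow_carrier_mat[of A 2 i]
    by (simp add: M2_pow mult_carrier_mat)
  then show ?thesis
    using assms unfolding eval_M2_def eval_def by (auto simp: ring_mat_simps(1) UP_def
       intro!: M2_finsum_carrier)
qed

text \<open>Convolution of matrix coefficients is matrix multiplication of entry polynomials. As
  evaluation is not multiplicative, products are handled through this formula.\<close>

lemma entry_poly_mult:
  assumes f: "f \<in> carrier (UP M2)" and g: "g \<in> carrier (UP M2)" and rc: "r < 2" "c < 2"
  shows "entry_poly (f \<otimes>\<^bsub>UP M2\<^esub> g) r c =
    entry_poly f r 0 * entry_poly g 0 c + entry_poly f r 1 * entry_poly g 1 c"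
proof (rule poly_eqI)
  fix n
  interpret UP_ring "M2 :: 'a mat ring" "UP M2"
    by (simp add: UP_ring_def ring_mat)
  note [simp] = UP_M2_coeff_carrier[OF f] UP_M2_coeff_carrier[OF g]
  have "(f \<otimes>\<^bsub>UP M2\<^esub> g) n = (\<Oplus>\<^bsub>M2\<^esub>i\<in>{..n}. f i * g (n - i))"
    using f g by (simp add: UP_def ring_mat_simps)
  then have "(f \<otimes>\<^bsub>UP M2\<^esub> g) n $$ (r, c) = (\<Sum>i\<le>n. (f i * g (n - i)) $$ (r, c))"
    using rc mult_carrier_mat[of "f _" 2 2 "g _" 2] by (simp add: M2_finsum_index)
  also have "\<dots> = (\<Sum>i\<le>n. f i $$ (r, 0) * g (n - i) $$ (0, c) + f i $$ (r, 1) * g (n - i) $$ (1, c))"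
    using rc by (intro sum.cong refl mat2_mult_index) auto
  finally show "coeff (entry_poly (f \<otimes>\<^bsub>UP M2\<^esub> g) r c) n =
    coeff (entry_poly f r 0 * entry_poly g 0 c + entry_poly f r 1 * entry_poly g 1 c) n"
    using rc f g P.m_closed[OF f g] by (simp add: coeff_entry_poly Polynomial.coeff_mult sum.distrib)
qed

lemma entry_poly_add:
  assumes "f \<in> carrier (UP M2)" "g \<in> carrier (UP M2)" "r < 2" "c < 2"
  shows "entry_poly (f \<oplus>\<^bsub>UP M2\<^esub> g) r c = entry_poly f r c + entry_poly g r c"
proof (rule poly_eqI)
  fix n
  interpret UP_ring "M2 :: 'a mat ring" "UP M2"
    by (simp add: UP_ring_def ring_mat)
  note [simp] = UP_M2_coeff_carrier[OF assms(1)] UP_M2_coeff_carrier[OF assms(2)]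
  have "(f \<oplus>\<^bsub>UP M2\<^esub> g) n = f n + g n"
    using assms by (simp add: UP_def ring_mat_simps)
  then show "coeff (entry_poly (f \<oplus>\<^bsub>UP M2\<^esub> g) r c) n = coeff (entry_poly f r c + entry_poly g r c) n"
    using assms carrier_matD[OF UP_M2_coeff_carrier[OF assms(2), of n]] by (simp add: coeff_entry_poly)
qed

lemma entry_poly_zero: "r < 2 \<Longrightarrow> c < 2 \<Longrightarrow> entry_poly (\<zero>\<^bsub>UP M2\<^esub>) r c = 0"
proof (rule poly_eqI)
  fix n assume rc: "r < 2" "c < 2"
  interpret UP_ring "M2 :: 'a mat ring" "UP M2"
    by (simp add: UP_ring_def ring_mat)
  show "coeff (entry_poly (\<zero>\<^bsub>UP M2\<^esub> :: nat \<Rightarrow> 'a mat) r c) n = coeff 0 n"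
    using rc coeff_entry_poly[OF P.zero_closed rc] by (simp add: UP_def ring_mat_simps)
qed

section \<open>Nilpotent matrices and the decomposition of the SQR class\<close>

text \<open>
  Up to the scalar \<open>c\<close>, a nonzero nilpotent matrix is determined by its kernel, a point of the
  projective line, which the type \<^typ>\<open>'a option\<close> encodes: \<open>Some y\<close> is the span of \<open>(1, y)\<close> and
  \<open>None\<close> the span of \<open>(0, 1)\<close>.
\<close>
definition nilpotent_mat :: "'a::field option \<Rightarrow> 'a \<Rightarrow> 'a mat" where
  "nilpotent_mat l c = mat 2 2 (\<lambda>(i, j). case l of
      None \<Rightarrow> if i = 1 \<and> j = 0 then c else 0
    | Some y \<Rightarrow> if i = 0 then (if j = 0 then - c * y else c) else (if j = 0 then - c * y * y else c * y))"

lemma nilpotent_mat_carrier [simp]: "nilpotent_mat l c \<in> carrier_mat 2 2"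
  by (simp add: nilpotent_mat_def)

lemma nilpotent_mat_index [simp]:
  "nilpotent_mat None c $$ (0, 0) = 0" "nilpotent_mat None c $$ (0, Suc 0) = 0"
  "nilpotent_mat None c $$ (Suc 0, 0) = c" "nilpotent_mat None c $$ (Suc 0, Suc 0) = 0"
  "nilpotent_mat (Some y) c $$ (0, 0) = - c * y" "nilpotent_mat (Some y) c $$ (0, Suc 0) = c"
  "nilpotent_mat (Some y) c $$ (Suc 0, 0) = - c * y * y"
  "nilpotent_mat (Some y) c $$ (Suc 0, Suc 0) = c * y"
  by (simp_all add: nilpotent_mat_def)

interpretation nilpotent_mat: square_zero "nilpotent_mat l c"
proof
  show "nilpotent_mat l c * nilpotent_mat l c = 0\<^sub>m 2 2"
  proof (rule mat2_eqI)
    fix i j :: nat assume "i < 2" "j < 2"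
    then show "(nilpotent_mat l c * nilpotent_mat l c) $$ (i, j) = 0\<^sub>m 2 2 $$ (i, j)"
      by (cases l) (auto simp: mat2_mult_index less_2_cases_iff)
  qed (auto intro: mult_carrier_mat[where n = 2])
qed simp

text \<open>The entry \<open>r\<close> in the upper right corner decides. If it is 0, squaring to
  zero kills the diagonal and the kernel is \<open>None\<close>; otherwise the trace is 0, the scale
  is \<open>r\<close> and the slope of the kernel is \<open>- p / r\<close>.\<close>

lemma (in square_zero) eq_nilpotent_mat:
  assumes "N \<noteq> 0\<^sub>m 2 2"
  obtains l c where "c \<noteq> 0" "N = nilpotent_mat l c"
proof -
  have sq: "N $$ (r, 0) * N $$ (0, c) + N $$ (r, 1) * N $$ (1, c) = 0"
    if "r < 2" "c < 2" for r c
    using mat2_mult_index[OF carrier_N carrier_N that] that by (simp add: square_N)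
  define p r s t where prst: "p = N $$ (0, 0)" "r = N $$ (0, 1)" "s = N $$ (1, 0)" "t = N $$ (1, 1)"
  have e: "p * p + r * s = 0" "p * r + r * t = 0" "s * p + t * s = 0" "s * r + t * t = 0"
    using sq[of 0 0] sq[of 0 1] sq[of 1 0] sq[of 1 1] by (simp_all add: prst)
  show ?thesis
  proof (cases "r = 0")
    case True
    then have "p = 0" "t = 0" using e by auto
    then have N: "N = nilpotent_mat None s"
      using True by (intro mat2_eqI) (auto simp: prst less_2_cases_iff)
    have "s \<noteq> 0"
    proof
      assume "s = 0"
      then have "N = 0\<^sub>m 2 2"
        using True \<open>p = 0\<close> \<open>t = 0\<close> by (intro mat2_eqI) (auto simp: prst less_2_cases_iff)
      with assms show False ..
    qed
    with N that show ?thesis by blast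
  next
    case False
    from e(2) have "r * (p + t) = 0" by (simp add: algebra_simps)
    with False have t: "t = - p" by (simp add: eq_neg_iff_add_eq_0 add.commute)
    from e(1) False have s: "s = - (p * p) / r" by (simp add: field_simps eq_neg_iff_add_eq_0)
    have "N = nilpotent_mat (Some (- p / r)) r"
      using False s t by (intro mat2_eqI) (auto simp: prst less_2_cases_iff)
    with False that show ?thesis by blast
  qed
qed

text \<open>The parameter 0 is left out because it gives the scalar matrix \<open>a\<close>, whose
  minimal polynomial is \<open>x - a\<close>.\<close>

definition sqr_line :: "'a::field \<Rightarrow> 'a option \<Rightarrow> 'a mat set" where
  "sqr_line a l = (\<lambda>c. a \<cdot>\<^sub>m 1\<^sub>m 2 + nilpotent_mat l c) ` (- {0})"

lemma scalar_poly_eval_carrier: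
  assumes "A \<in> carrier_mat 2 2"
  shows "scalar_poly_eval p A \<in> carrier_mat 2 2"
  unfolding scalar_poly_eval_def using assms by (intro M2_finsum_carrier) (auto simp: pow_carrier_mat)

text \<open>Take \<open>N = A - a\<close>. Annihilation by \<open>(x - a)^2\<close> says
  \<open>N * N = 0\<close>, and minimality of the degree excludes \<open>N = 0\<close>.\<close>

lemma SQR_class_square_zero:
  assumes "A \<in> SQR_class a"
  obtains N where "square_zero N" "N \<noteq> 0\<^sub>m 2 2" "A = a \<cdot>\<^sub>m 1\<^sub>m 2 + N"
proof -
  have A: "A \<in> carrier_mat 2 2" and "is_min_poly A ([:- a, 1:] ^ 2)"
    using assms by (auto simp: SQR_class_def min_poly_class_def ring_mat_simps)
  then have root: "scalar_poly_eval ([:- a, 1:] ^ 2) A = 0\<^sub>m 2 2"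
    and min: "\<And>p. p \<noteq> 0 \<Longrightarrow> scalar_poly_eval p A = 0\<^sub>m 2 2 \<Longrightarrow> degree ([:- a, 1:] ^ 2) \<le> degree p"
    by (auto simp: is_min_poly_def ring_mat_simps)
  have [simp]: "dim_row A = 2" "dim_col A = 2" using A by auto
  have p: "[:- a, 1:] ^ 2 = [:a * a, - 2 * a, 1:]"
    by (simp add: power2_eq_square)
  define N where "N = A - a \<cdot>\<^sub>m 1\<^sub>m 2"
  have N: "N \<in> carrier_mat 2 2" and AN: "A = a \<cdot>\<^sub>m 1\<^sub>m 2 + N"
    using A by (auto simp: N_def intro!: mat2_eqI)
  have A2: "A ^\<^sub>m 2 = A * A" "A ^\<^sub>m Suc 0 = A"
    using A by (auto simp: numeral_2_eq_2)
  have "N * N = scalar_poly_eval ([:- a, 1:] ^ 2) A"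
  proof (rule mat2_eqI)
    fix r c :: nat assume rc: "r < 2" "c < 2"
    have "scalar_poly_eval ([:- a, 1:] ^ 2) A $$ (r, c) =
      (\<Sum>i\<le>2. (poly.coeff [:a * a, - 2 * a, 1:] i \<cdot>\<^sub>m (A ^\<^sub>m i)) $$ (r, c))"
      unfolding scalar_poly_eval_def p using A rc
      by (subst M2_finsum_index) (auto simp: pow_carrier_mat numeral_2_eq_2)
    also have "\<dots> = a * a * (if r = c then 1 else 0) - 2 * a * A $$ (r, c) + (A * A) $$ (r, c)"
    proof -
      have sum3: "(\<Sum>i\<le>2. F i) = F 0 + F 1 + F 2" for F :: "nat \<Rightarrow> 'a"
        by (simp add: numeral_2_eq_2)
      have "coeff [:a * a, - 2 * a, 1:] 2 = 1" by (simp add: numeral_2_eq_2)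
      with rc show ?thesis unfolding sum3 by (simp add: A2)
    qed
    also have "\<dots> = (N * N) $$ (r, c)"
    proof -
      have N_index: "N $$ (i, j) = A $$ (i, j) - (if i = j then a else 0)" if "i < 2" "j < 2" for i j
        using that by (simp add: N_def)
      from rc show ?thesis
        unfolding mat2_mult_index[OF N N rc] mat2_mult_index[OF A A rc]
        by (auto simp: N_index less_2_cases_iff algebra_simps)
    qed
    finally show "(N * N) $$ (r, c) = scalar_poly_eval ([:- a, 1:] ^ 2) A $$ (r, c)" ..
  qed (use A N scalar_poly_eval_carrier in auto)
  with root N have sq: "square_zero N" by (simp add: square_zero_def)
  have "N \<noteq> 0\<^sub>m 2 2"
  proof
    assume N0: "N = 0\<^sub>m 2 2"
    \<comment> \<open>For \<open>N = 0\<close> the linear polynomial \<open>x - a\<close> would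
      already annihilate \<open>A\<close>.\<close>
    have "scalar_poly_eval [:- a, 1:] A = 0\<^sub>m 2 2"
      using square_zero.scalar_poly_eval_scalar_plus[OF sq, of _ _ "[:- a, 1:]" a] A
      unfolding AN[symmetric]
      by (intro mat2_eqI scalar_poly_eval_carrier) (auto simp: N0)
    from min[OF _ this] show False by (simp add: p)
  qed
  with sq AN that show ?thesis by blast
qed

text \<open>\<open>(x - a)^2\<close> and its derivative vanish at \<open>a\<close>, so the Taylor
  formula gives annihilation. A polynomial \<open>u + v x\<close> takes the value
  \<open>(u + a v) + v N\<close>, which is zero only for \<open>u = v = 0\<close>.\<close>

lemma sqr_line_subset_SQR_class: "sqr_line a l \<subseteq> SQR_class a"
proof
  fix A assume "A \<in> sqr_line a l"
  then obtain c where c: "c \<noteq> 0" and A: "A = a \<cdot>\<^sub>m 1\<^sub>m 2 + nilpotent_mat l c"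
    by (auto simp: sqr_line_def)
  have Ac: "A \<in> carrier_mat 2 2" by (simp add: A)
  have p: "[:- a, 1:] ^ 2 = [:a * a, - 2 * a, 1:]"
    by (simp add: power2_eq_square)
  note ev = nilpotent_mat.scalar_poly_eval_scalar_plus[of _ _ _ a l c, folded A]
  have "scalar_poly_eval ([:- a, 1:] ^ 2) A = 0\<^sub>m 2 2"
    using Ac by (intro mat2_eqI scalar_poly_eval_carrier) (auto simp: ev p pderiv_pCons)
  moreover have "2 \<le> degree p" if "p \<noteq> 0" and 0: "scalar_poly_eval p A = 0\<^sub>m 2 2" for p
  proof (rule ccontr)
    assume "\<not> 2 \<le> degree p"
    then have "degree p \<le> 1" by simp
    then obtain u v where uv: "p = [:u, v:]"
      by (intro that[of "coeff p 0" "coeff p 1"] poly_eqI)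
        (auto simp: coeff_pCons coeff_eq_0 split: nat.split)
    have e: "(if i = j then u + a * v else 0) + v * nilpotent_mat l c $$ (i, j) = 0"
      if "i < 2" "j < 2" for i j
      using ev[OF that, of "[:u, v:]"] 0 that by (auto simp: uv pderiv_pCons split: if_splits)
    \<comment> \<open>One off-diagonal entry of \<open>nilpotent_mat l c\<close> is \<open>c\<close>
      itself, at position (1, 0) for \<open>None\<close> and (0, 1) for \<open>Some\<close>.\<close>
    have "v = 0" using e[of 0 1] e[of 1 0] c by (cases l) auto
    with e[of 0 0] \<open>p \<noteq> 0\<close> uv show False by simp
  qed
  ultimately show "A \<in> SQR_class a"
    using Ac by (auto simp: SQR_class_def min_poly_class_def is_min_poly_def ring_mat_simps p numeral_2_eq_2)
qed

lemma SQR_class_eq: "SQR_class a = (\<Union>l. sqr_line a l)"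
proof
  show "SQR_class a \<subseteq> (\<Union>l. sqr_line a l)"
  proof
    fix A assume "A \<in> SQR_class a"
    then obtain N where N: "square_zero N" "N \<noteq> 0\<^sub>m 2 2" "A = a \<cdot>\<^sub>m 1\<^sub>m 2 + N"
      by (rule SQR_class_square_zero)
    then show "A \<in> (\<Union>l. sqr_line a l)"
      by (metis (no_types, lifting) ComplI UN_iff UNIV_I image_eqI singletonD sqr_line_def
          square_zero.eq_nilpotent_mat)
  qed
qed (use sqr_line_subset_SQR_class in blast)

text \<open>At \<open>c = 0\<close> all lines would meet in the scalar matrix, so \<open>l\<close>
  is determined only for \<open>c\<close> nonzero; the entries then force \<open>d\<close> to be
  nonzero too.\<close>

lemma scalar_plus_nilpotent_mat_eqD:
  assumes eq: "a \<cdot>\<^sub>m 1\<^sub>m 2 + nilpotent_mat l c = a \<cdot>\<^sub>m 1\<^sub>m 2 + nilpotent_mat m d" and "c \<noteq> 0"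
  shows "l = m" "c = d"
proof -
  have *: "nilpotent_mat l c $$ (i, j) = nilpotent_mat m d $$ (i, j)" if "i < 2" "j < 2" for i j
    using arg_cong[OF eq, of "\<lambda>A. A $$ (i, j)"] that by simp
  show "l = m" "c = d"
    using *[of 0 0] *[of 0 1] *[of 1 0] *[of 1 1] \<open>c \<noteq> 0\<close>
    by (cases l; cases m; force)+
qed

lemma sqr_line_disjoint: "l \<noteq> m \<Longrightarrow> sqr_line a l \<inter> sqr_line a m = {}"
  by (auto simp: sqr_line_def dest: scalar_plus_nilpotent_mat_eqD)

lemma card_sqr_line: "card (sqr_line (a :: 'a::{field,finite}) l) = CARD('a) - 1"
proof -
  have "inj_on (\<lambda>c. a \<cdot>\<^sub>m 1\<^sub>m 2 + nilpotent_mat l c) (- {0})"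
    by (rule inj_onI) (auto dest: scalar_plus_nilpotent_mat_eqD)
  then show ?thesis by (simp add: sqr_line_def card_image Compl_eq_Diff_UNIV card_Diff_singleton)
qed

section \<open>Null ideals and core subsets\<close>

lemma null_ideal_iff:
  assumes "S \<subseteq> carrier_mat 2 2"
  shows "f \<in> null_ideal S \<longleftrightarrow> f \<in> carrier (UP M2) \<and>
    (\<forall>A\<in>S. \<forall>i<2. \<forall>j<2. eval_M2 f A $$ (i, j) = 0)"
  using assms eval_M2_carrier
  by (auto simp: null_ideal_def ring_mat_simps intro!: mat2_eqI)

lemma sqr_line_carrier: "sqr_line a l \<subseteq> carrier_mat 2 2"
  by (auto simp: sqr_line_def)

lemma SQR_class_carrier: "SQR_class a \<subseteq> carrier_mat 2 2"
  using sqr_line_carrier by (auto simp: SQR_class_eq)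

text \<open>This is the ideal generated by the central polynomial \<open>(x - a)^2\<close>;
  divisibility is encoded by value and derivative to match the Taylor formula.\<close>

definition double_root_ideal :: "'a::field \<Rightarrow> (nat \<Rightarrow> 'a mat) set" where
  "double_root_ideal a = {f \<in> carrier (UP M2). \<forall>i<2. \<forall>j<2.
     poly (entry_poly f i j) a = 0 \<and> poly (pderiv (entry_poly f i j)) a = 0}"

text \<open>By the product rule a double root survives multiplication by any polynomial, and each
  summand of an entry of a product has a factor from the ideal, whichever side it is on.\<close>

lemma ideal_double_root_ideal: "ideal (double_root_ideal a) (UP M2)"
proof -
  interpret UP_ring "M2 :: 'a mat ring" "UP M2"
    by (simp add: UP_ring_def ring_mat)
  have uminus: "entry_poly (\<ominus>\<^bsub>UP M2\<^esub> f) i j = - entry_poly f i j"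
    if f: "f \<in> carrier (UP M2)" and ij: "i < 2" "j < 2" for f :: "nat \<Rightarrow> 'a mat" and i j
    using entry_poly_add[OF P.a_inv_closed[OF f] f ij] entry_poly_zero[OF ij, where 'a = 'a]
    by (simp add: P.l_neg[OF f] eq_neg_iff_add_eq_0)
  show ?thesis
  proof (rule idealI)
    show "ring (UP M2 :: (_, nat \<Rightarrow> 'a mat) up_ring)" by (rule UP_ring)
    show "subgroup (double_root_ideal a) (add_monoid (UP M2))"
    proof (rule P.add.subgroupI)
      show "double_root_ideal a \<noteq> {}"
        using P.zero_closed by (auto simp: double_root_ideal_def entry_poly_zero)
    qed (auto simp: double_root_ideal_def entry_poly_add uminus pderiv_add pderiv_minus)
  qed (auto simp: double_root_ideal_def entry_poly_mult pderiv_add pderiv_mult)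
qed

text \<open>The two matrices give four linear equations for the four values that row
  \<open>i\<close> of \<open>f\<close> contributes. Different kernels make the system nonsingular;
  it is solved by elimination, without forming an inverse.\<close>

lemma core_two_lines:
  assumes S: "S \<subseteq> SQR_class a"
    and A: "A \<in> S" "A \<in> sqr_line a l" and B: "B \<in> S" "B \<in> sqr_line a m" and "l \<noteq> m"
  shows "core S"
proof -
  have "null_ideal S = double_root_ideal a"
  proof (rule Set.set_eqI)
    fix f
    show "f \<in> null_ideal S \<longleftrightarrow> f \<in> double_root_ideal a"
    proof (cases "f \<in> carrier (UP M2)")
      case f: True
      note ev = nilpotent_mat.eval_M2_scalar_plus[OF f]
      show ?thesis
      proof
        assume null: "f \<in> null_ideal S"
        obtain c d where c: "c \<noteq> 0" "A = a \<cdot>\<^sub>m 1\<^sub>m 2 + nilpotent_mat l c"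
          and d: "d \<noteq> 0" "B = a \<cdot>\<^sub>m 1\<^sub>m 2 + nilpotent_mat m d"
          using A B by (auto simp: sqr_line_def)
        have eval0: "eval_M2 f A $$ (i, j) = 0" "eval_M2 f B $$ (i, j) = 0" if "i < 2" "j < 2" for i j
          using null that A B S SQR_class_carrier[of a] by (auto simp: null_ideal_iff)
        have "poly (entry_poly f i 0) a = 0 \<and> poly (entry_poly f i 1) a = 0 \<and>
          poly (pderiv (entry_poly f i 0)) a = 0 \<and> poly (pderiv (entry_poly f i 1)) a = 0"
          if i: "i < 2" for i
        proof -
          \<comment> \<open>\<open>(u, v)\<close> and \<open>(x, y)\<close> are row \<open>i\<close>
            of \<open>f(a)\<close> and of \<open>f'(a)\<close>.\<close>
          define u v x y where
            "u = poly (entry_poly f i 0) a" "v = poly (entry_poly f i 1) a"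
            "x = poly (pderiv (entry_poly f i 0)) a" "y = poly (pderiv (entry_poly f i 1)) a"
          note defs = this
          \<comment> \<open>Both columns of \<open>(u, v) + (x, y) N = 0\<close>, where
            \<open>x + y * z\<close> pairs \<open>(x, y)\<close> with the vector
            \<open>(1, z)\<close> spanning the kernel and the image of \<open>N\<close>.\<close>
          have cond: "case n of None \<Rightarrow> u + y * e = 0 \<and> v = 0 |
              Some z \<Rightarrow> v + e * (x + y * z) = 0 \<and> u - e * z * (x + y * z) = 0"
            if "\<And>j. j < 2 \<Longrightarrow> eval_M2 f (a \<cdot>\<^sub>m 1\<^sub>m 2 + nilpotent_mat n e) $$ (i, j) = 0" for n e
            using that[of 0] that[of 1] i
            by (cases n) (auto simp: ev defs algebra_simps)
          have some_none: "u = 0 \<and> v = 0 \<and> x = 0 \<and> y = 0"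
            if "v + e * (x + y * z) = 0" "u - e * z * (x + y * z) = 0"
              "u + y * e' = 0" "v = 0" "e \<noteq> 0" "e' \<noteq> 0" for e e' z
            using that by auto
          have some_some: "u = 0 \<and> v = 0 \<and> x = 0 \<and> y = 0"
            if h: "v + e * (x + y * z) = 0" "u - e * z * (x + y * z) = 0"
              "v + e' * (x + y * z') = 0" "u - e' * z' * (x + y * z') = 0"
              "e \<noteq> 0" "e' \<noteq> 0" "z \<noteq> z'" for e e' z z'
          proof -
            \<comment> \<open>Multiplying by the kernel vector \<open>(1, z)\<close> removes the
              derivative term; two distinct slopes then force \<open>u = v = 0\<close>.\<close>
            have "u + z * v = (u - e * z * (x + y * z)) + z * (v + e * (x + y * z))"
              "u + z' * v = (u - e' * z' * (x + y * z')) + z' * (v + e' * (x + y * z'))"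
              by (simp_all add: algebra_simps)
            then have uv: "u + z * v = 0" "u + z' * v = 0" by (simp_all add: h(1-4))
            have "(z - z') * v = (u + z * v) - (u + z' * v)" by (simp add: algebra_simps)
            with h(7) uv have v: "v = 0" by simp
            with h(1,3,5,6) have xy: "x + y * z = 0" "x + y * z' = 0" by simp_all
            have "y * (z - z') = (x + y * z) - (x + y * z')" by (simp add: algebra_simps)
            then have "y * (z - z') = 0" by (simp add: xy)
            with h(7) have "y = 0" by simp
            with xy v uv show ?thesis by simp
          qed
          have "u = 0 \<and> v = 0 \<and> x = 0 \<and> y = 0"
          proof -
            note A = cond[OF eval0(1)[OF i, unfolded c(2)]]
            note B = cond[OF eval0(2)[OF i, unfolded d(2)]]
            consider z where "l = None" "m = Some z" | z where "l = Some z" "m = None"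
              | z z' where "l = Some z" "m = Some z'" "z \<noteq> z'"
              using \<open>l \<noteq> m\<close> by (cases l; cases m) auto
            then show ?thesis
            proof cases
              case (1 z)
              with A B c(1) d(1) show ?thesis by (intro some_none[of d z c]) simp_all
            next
              case (2 z)
              with A B c(1) d(1) show ?thesis by (intro some_none[of c z d]) simp_all
            next
              case (3 z z')
              with A B c(1) d(1) show ?thesis by (intro some_some[of c z d z']) simp_all
            qed
          qed
          then show ?thesis by (simp add: defs)
        qed
        then show "f \<in> double_root_ideal a"
          using f by (auto simp: double_root_ideal_def less_2_cases_iff)
      next
        \<comment> \<open>Conversely, all terms of the Taylor formula vanish at every matrix of the
          class.\<close>
        assume dr: "f \<in> double_root_ideal a"
        show "f \<in> null_ideal S"
          unfolding null_ideal_iff[OF order_trans[OF S SQR_class_carrier]]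
        proof (intro conjI f ballI allI impI)
          fix A i j assume "A \<in> S" and ij: "i < (2::nat)" "j < (2::nat)"
          then obtain n e where "A = a \<cdot>\<^sub>m 1\<^sub>m 2 + nilpotent_mat n e"
            using S unfolding SQR_class_eq sqr_line_def by blast
          then show "eval_M2 f A $$ (i, j) = 0"
            using dr ij by (simp add: ev double_root_ideal_def)
        qed
      qed
    qed (auto simp: null_ideal_def double_root_ideal_def)
  qed
  then show ?thesis by (simp add: core_def ideal_double_root_ideal)
qed

lemma core_empty: "core {}"
proof -
  interpret UP_ring "M2 :: 'a mat ring" "UP M2"
    by (simp add: UP_ring_def ring_mat)
  show ?thesis using P.oneideal by (simp add: core_def null_ideal_def)
qed

section \<open>Noncore subsets and their number\<close>

lemma linear_UP_M2:
  assumes "B \<in> carrier_mat 2 2" "C \<in> carrier_mat 2 2"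
  shows "(\<lambda>n. if n = 0 then B else if n = 1 then C else 0\<^sub>m 2 2) \<in> carrier (UP M2)" (is "?f \<in> _")
    and "i < 2 \<Longrightarrow> j < 2 \<Longrightarrow>
      entry_poly (\<lambda>n. if n = 0 then B else if n = 1 then C else 0\<^sub>m 2 2) i j = [:B $$ (i, j), C $$ (i, j):]"
proof -
  have "bound (0\<^sub>m 2 2) 1 ?f" by auto
  then show f: "?f \<in> carrier (UP M2)"
    using assms by (auto simp: UP_def ring_mat_simps intro!: mem_upI)
  assume ij: "i < 2" "j < 2"
  show "entry_poly ?f i j = [:B $$ (i, j), C $$ (i, j):]"
    using ij by (intro poly_eqI) (auto simp: coeff_entry_poly[OF f ij] coeff_pCons split: nat.split)
qed

text \<open>Closure under right multiplication fails: at \<open>a + e M\<close> the polynomial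
  \<open>M(x - a)\<close> has value \<open>e M M = 0\<close>, but \<open>M(x - a)E\<close> has value
  \<open>e M E M\<close>.\<close>

lemma noncore_sqr_line:
  assumes S: "S \<subseteq> sqr_line a l" "S \<noteq> {}"
  shows "noncore S"
proof
  assume "core S"
  then interpret ideal "null_ideal S" "UP M2" by (simp add: core_def)
  define M where "M = nilpotent_mat l 1"
  \<comment> \<open>The single 1 is placed so that \<open>M * E * M = M\<close> for either form of
    \<open>l\<close>.\<close>
  define E :: "'a mat" where "E = mat 2 2 (\<lambda>(i, j). if l = None \<and> i = 0 \<and> j = 1 \<or> l \<noteq> None \<and> i = 1 \<and> j = 0 then 1 else 0)"
  have E: "E \<in> carrier_mat 2 2" and M: "M \<in> carrier_mat 2 2" by (simp_all add: E_def M_def)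
  define f where "f = (\<lambda>n::nat. if n = 0 then - a \<cdot>\<^sub>m M else if n = 1 then M else 0\<^sub>m 2 2)"
  \<comment> \<open>The constant \<open>E\<close>, written with a redundant case to fit the shape in
    \<open>linear_UP_M2\<close>.\<close>
  define g where "g = (\<lambda>n::nat. if n = 0 then E else if n = 1 then 0\<^sub>m 2 2 else 0\<^sub>m 2 2)"
  have f: "f \<in> carrier (UP M2)" and g: "g \<in> carrier (UP M2)"
    unfolding f_def g_def using M E by (auto intro!: linear_UP_M2)
  have fij: "entry_poly f i j = [:- a * M $$ (i, j), M $$ (i, j):]"
    and gij: "entry_poly g i j = [:E $$ (i, j):]" if "i < 2" "j < 2" for i j
    unfolding f_def g_def using M E that by (subst linear_UP_M2; simp)+
  have carr: "S \<subseteq> carrier_mat 2 2" using S sqr_line_carrier by blast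
  have "f \<in> null_ideal S"
    unfolding null_ideal_iff[OF carr]
  proof (intro conjI f ballI allI impI)
    fix A i j assume "A \<in> S" and ij: "i < (2::nat)" "j < (2::nat)"
    then obtain e where A: "A = a \<cdot>\<^sub>m 1\<^sub>m 2 + nilpotent_mat l e"
      using S by (auto simp: sqr_line_def)
    show "eval_M2 f A $$ (i, j) = 0"
      unfolding A nilpotent_mat.eval_M2_scalar_plus[OF f ij] using ij
      by (cases l) (auto simp: fij pderiv_pCons M_def less_2_cases_iff)
  qed
  then have "f \<otimes>\<^bsub>UP M2\<^esub> g \<in> null_ideal S" using g by (rule I_r_closed)
  moreover obtain A where "A \<in> S" using S by blast
  moreover from this obtain e where e: "e \<noteq> 0" and A: "A = a \<cdot>\<^sub>m 1\<^sub>m 2 + nilpotent_mat l e"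
    using S by (auto simp: sqr_line_def)
  ultimately have fg: "f \<otimes>\<^bsub>UP M2\<^esub> g \<in> carrier (UP M2)"
    and 0: "\<And>i j. i < 2 \<Longrightarrow> j < 2 \<Longrightarrow>
      eval_M2 (f \<otimes>\<^bsub>UP M2\<^esub> g) (a \<cdot>\<^sub>m 1\<^sub>m 2 + nilpotent_mat l e) $$ (i, j) = 0"
    unfolding null_ideal_iff[OF carr] by auto
  \<comment> \<open>The value is \<open>nilpotent_mat l e\<close>, which has \<open>e\<close> as an
    off-diagonal entry.\<close>
  show False
    using 0[of 0 1] 0[of 1 0] e nilpotent_mat.eval_M2_scalar_plus[OF fg, of _ _ a l e]
    by (cases l) (auto simp: entry_poly_mult[OF f g] fij gij pderiv_pCons M_def E_def)
qed

text \<open>Fix the line of one element; by \<open>core_two_lines\<close> no other element of a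
  noncore set can leave it.\<close>

lemma noncore_iff:
  assumes "S \<subseteq> SQR_class a"
  shows "noncore S \<longleftrightarrow> S \<noteq> {} \<and> (\<exists>l. S \<subseteq> sqr_line a l)"
proof
  assume S: "noncore S"
  then have "S \<noteq> {}" using core_empty by blast
  then obtain A where "A \<in> S" by blast
  then obtain l where l: "A \<in> sqr_line a l" using assms by (auto simp: SQR_class_eq)
  have "S \<subseteq> sqr_line a l"
  proof
    fix B assume "B \<in> S"
    then obtain m where m: "B \<in> sqr_line a m" using assms by (auto simp: SQR_class_eq)
    have "l = m" using core_two_lines[OF assms \<open>A \<in> S\<close> l \<open>B \<in> S\<close> m] S by blast
    with m show "B \<in> sqr_line a l" by simp
  qed
  with \<open>S \<noteq> {}\<close> show "S \<noteq> {} \<and> (\<exists>l. S \<subseteq> sqr_line a l)" by blast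
qed (use noncore_sqr_line in blast)

theorem theorem2:
  fixes a :: "'a::{field,finite}" and q :: nat
  assumes "q = card (UNIV :: 'a set)"
  shows "card {S. S \<subseteq> SQR_class a \<and> noncore S} = (q + 1) * (2 ^ (q - 1) - 1)"
proof -
  have fin: "finite (sqr_line a l)" for l by (simp add: sqr_line_def)
  have "{S. S \<subseteq> SQR_class a \<and> noncore S} = (\<Union>l. Pow (sqr_line a l) - {{}})"
  proof (intro Set.set_eqI iffI)
    fix S assume "S \<in> (\<Union>l. Pow (sqr_line a l) - {{}})"
    then obtain l where "S \<subseteq> sqr_line a l" "S \<noteq> {}" by blast
    then show "S \<in> {S. S \<subseteq> SQR_class a \<and> noncore S}"
      using noncore_sqr_line sqr_line_subset_SQR_class by blast
  next
    fix S assume "S \<in> {S. S \<subseteq> SQR_class a \<and> noncore S}"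
    then show "S \<in> (\<Union>l. Pow (sqr_line a l) - {{}})"
      using noncore_iff[of S a] by blast
  qed
  \<comment> \<open>Without the empty set, the families belonging to different lines are disjoint.
    They are indexed by \<open>'a option\<close>, which has \<open>q + 1\<close> elements.\<close>
  also have "card \<dots> = (\<Sum>l\<in>UNIV. card (Pow (sqr_line a l) - {{}}))"
    using sqr_line_disjoint[of _ _ a] fin by (intro card_UN_disjoint) (simp, simp, blast)
  also have "\<dots> = (q + 1) * (2 ^ (q - 1) - 1)"
    using fin by (simp add: card_Diff_singleton card_Pow card_sqr_line card_UNIV_option assms)
  finally show ?thesis .
qed

end
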